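(* Let $f=a_0+a_1x+\cdots+a_mx^m\in\mathbb{Z}[x]$ be a primitive polynomial, where $m$ is a nonnegative integer. Suppose that there exists a positive real number $\alpha$ such that $$|a_m|\,\alpha^m>|a_0|+|a_1|\,\alpha+\cdots+|a_{m-1}|\,\alpha^{m-1}.$$ If there exist natural numbers $n$ and $d$ satisfying $n\geq \alpha+d$ for which either $|f(n)|/d$ is a prime number, or $|f(n)|/d$ is a prime-power coprime to $|f'(n)|$, then $f$ is irreducible in $\mathbb{Z}[x]$.
   Context: Natural numbers are positive integers. A polynomial in $\mathbb{Z}[x]$ is primitive if the greatest common divisor of its coefficients is $1$. A prime-power is an integer of the form $p^k$ with $p$ a prime number and $k$ a positive integer; in particular, the hypothesis that $|f(n)|/d$ is a prime or a prime-power includes that it is an integer. $f'$ denotes the formal derivative of $f$ with respect to $x$. Irreducible in $\mathbb{Z}[x]$ means irreducible as an element of the ring $\mathbb{Z}[x]$. *)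

theory Defs
  imports
    "HOL-Computational_Algebra.Computational_Algebra"
    "HOL-Number_Theory.Prime_Powers"
begin

end

theory Submission
  imports Defs
begin

text \<open>
  The dominance of the leading coefficient keeps every complex root of \<open>f\<close> inside the open disc of
  radius \<open>\<alpha>\<close> (\<open>dominant_leading_coeff_imp_root_bound\<close>), so \<open>n\<close> is at distance more than \<open>d\<close> from all
  roots.  An integer polynomial of positive degree whose roots are among those of \<open>f\<close> therefore has a
  value of modulus greater than \<open>d\<close> at \<open>n\<close>: this value is a nonzero integer, the leading
  coefficient, times a nonempty product of such distances, each of them greater than \<open>d \<ge> 1\<close>
  (\<open>norm_poly_gt_if_far_from_roots\<close>).

  Now let \<open>f = g h\<close> with neither factor a unit.  Primitivity excludes constant factors, so
  \<open>\<bar>g(n)\<bar>\<close> and \<open>\<bar>h(n)\<bar>\<close> both exceed \<open>d\<close>, while their product is \<open>d q\<close> with \<open>q\<close> a prime or a power of a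
  prime \<open>p\<close>.  But \<open>q\<close> divides one of \<open>g(n)\<close>, \<open>h(n)\<close>: this is clear for a prime, and for a prime power
  it holds because \<open>p\<close> cannot divide both values, or else it would divide
  \<open>f'(n) = g'(n) h(n) + g(n) h'(n)\<close>.  The other value then divides \<open>d\<close>, which is impossible as its
  modulus is greater than \<open>d\<close>.
\<close>

lemma dominant_leading_coeff_imp_root_bound:
  fixes a :: "nat \<Rightarrow> complex" and \<alpha> :: real
  assumes "\<alpha> > 0"
    and dominant: "(\<Sum>i<m. norm (a i) * \<alpha> ^ i) < norm (a m) * \<alpha> ^ m"
    and root: "(\<Sum>i\<le>m. a i * z ^ i) = 0"
  shows "norm z < \<alpha>"
proof (rule ccontr)
  \<comment> \<open>The dominance inequality survives enlarging \<open>\<alpha>\<close> to \<open>\<alpha> r\<close>, since the left side grows by a factor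
    of at most \<open>r ^ m\<close> and the right side by exactly that factor.\<close>
  define r where "r = norm z / \<alpha>"
  assume "\<not> norm z < \<alpha>"
  hence r: "r \<ge> 1" and z: "norm z = \<alpha> * r"
    using \<open>\<alpha> > 0\<close> by (auto simp: r_def field_simps)
  have "a m * z ^ m = - (\<Sum>i<m. a i * z ^ i)"
    using root by (simp add: lessThan_Suc_atMost[symmetric] eq_neg_iff_add_eq_0 add.commute)
  hence "norm (a m) * norm z ^ m = norm (\<Sum>i<m. a i * z ^ i)"
    by (metis norm_minus_cancel norm_mult norm_power)
  also have "\<dots> \<le> (\<Sum>i<m. norm (a i) * norm z ^ i)"
    by (rule order_trans[OF norm_sum]) (simp add: norm_mult norm_power)
  also have "\<dots> \<le> (\<Sum>i<m. norm (a i) * \<alpha> ^ i * r ^ m)"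
  proof (rule sum_mono)
    fix i assume "i \<in> {..<m}"
    hence "r ^ i \<le> r ^ m" using r by (intro power_increasing) auto
    thus "norm (a i) * norm z ^ i \<le> norm (a i) * \<alpha> ^ i * r ^ m"
      using \<open>\<alpha> > 0\<close> by (simp add: z power_mult_distrib mult_left_mono mult.assoc)
  qed
  also have "\<dots> = (\<Sum>i<m. norm (a i) * \<alpha> ^ i) * r ^ m"
    by (simp add: sum_distrib_right)
  also have "\<dots> < norm (a m) * \<alpha> ^ m * r ^ m"
    using dominant r by (intro mult_strict_right_mono) auto
  also have "\<dots> = norm (a m) * norm z ^ m"
    by (simp add: z power_mult_distrib)
  finally show False by simp
qed

text \<open>
  Up to the leading coefficient, the value at \<open>x\<close> is the product of the distances from \<open>x\<close> to the
  roots; the induction splits off one root at a time.  A product of numbers greater than \<open>d\<close> is itself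
  greater than \<open>d\<close> only because \<open>d \<ge> 1\<close>.
\<close>
lemma norm_poly_gt_if_far_from_roots:
  fixes p :: "complex poly" and d :: real
  assumes "degree p > 0" and "norm (lead_coeff p) \<ge> 1" and "d \<ge> 1"
    and "\<And>z. poly p z = 0 \<Longrightarrow> norm (x - z) > d"
  shows "norm (poly p x) > d"
  using assms
proof (induction "degree p" arbitrary: p)
  case 0
  then show ?case by simp
next
  case (Suc k p)
  from \<open>degree p > 0\<close> have "\<not> constant (poly p)"
    by (simp add: constant_degree)
  then obtain z where z: "poly p z = 0"
    using fundamental_theorem_of_algebra by blast
  then obtain q where q: "p = [:-z, 1:] * q"
    by (auto simp: poly_eq_0_iff_dvd)
  have "q \<noteq> 0" using q \<open>degree p > 0\<close> by auto
  hence deg: "degree q = k"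
    using \<open>Suc k = degree p\<close> by (simp add: q degree_mult_eq del: mult_pCons_left)
  have lead: "norm (lead_coeff q) \<ge> 1"
    using Suc.prems(2) unfolding q lead_coeff_mult by simp
  have "norm (poly q x) \<ge> 1"
  proof (cases "k = 0")
    case True
    then obtain c where "q = [:c:]" using deg degree_eq_zeroE by blast
    thus ?thesis using lead by simp
  next
    case False
    hence "norm (poly q x) > d"
      using Suc.prems lead deg by (intro Suc.hyps(1)) (auto simp: q)
    thus ?thesis using \<open>d \<ge> 1\<close> by simp
  qed
  moreover have "norm (x - z) > d" using Suc.prems(4) z by blast
  ultimately have "d * 1 < norm (x - z) * norm (poly q x)"
    using \<open>d \<ge> 1\<close> by (intro mult_less_le_imp_less) auto
  also have "\<dots> = norm (poly p x)" by (simp add: q norm_mult[symmetric] algebra_simps)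
  finally show ?case by simp
qed

text \<open>A constant factor divides the content.\<close>
lemma degree_pos_if_dvd_primitive:
  fixes g :: "int poly"
  assumes "g dvd f" and "content f = 1" and "\<not> is_unit g"
  shows "degree g > 0"
proof (rule ccontr)
  assume "\<not> degree g > 0"
  then obtain c where c: "g = [:c:]" using degree_eq_zeroE by blast
  hence "c dvd content f"
    using \<open>g dvd f\<close> by (simp add: const_poly_dvd_iff_dvd_content)
  thus False using assms c by (simp add: is_unit_const_poly_iff)
qed

text \<open>A cofactor of \<open>q\<close> in \<open>d * q\<close> divides \<open>d\<close>, so it cannot exceed \<open>d\<close>.\<close>
lemma not_dvd_if_cofactor_gt:
  fixes u v q d :: int
  assumes "\<bar>u * v\<bar> = d * q" and "q \<noteq> 0" and "d > 0" and "\<bar>v\<bar> > d"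
  shows "\<not> q dvd u"
proof
  assume "q dvd u"
  hence "\<bar>q * v\<bar> dvd \<bar>u * v\<bar>" by simp
  hence "q * v dvd d * q" using assms(1) by simp
  hence "v dvd d" using \<open>q \<noteq> 0\<close> by (simp add: mult.commute)
  thus False using dvd_imp_le_int[of d v] \<open>d > 0\<close> \<open>\<bar>v\<bar> > d\<close> by simp
qed

text \<open>
  A common prime factor of \<open>g(n)\<close> and \<open>h(n)\<close> divides \<open>(g h)'(n)\<close> by the product rule, so \<open>p\<close> is prime
  to one of the two values and its whole power goes into the other.
\<close>
lemma prime_power_dvd_poly_factor:
  fixes g h :: "int poly"
  assumes "prime p" and "p ^ k dvd poly (g * h) x" and "\<not> p dvd poly (pderiv (g * h)) x"
  shows "p ^ k dvd poly g x \<or> p ^ k dvd poly h x"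
proof -
  have "\<not> (p dvd poly g x \<and> p dvd poly h x)"
    using assms(3) by (auto simp: pderiv_mult)
  hence "coprime (p ^ k) (poly g x) \<or> coprime (p ^ k) (poly h x)"
    using \<open>prime p\<close> by (auto simp: prime_imp_coprime)
  thus ?thesis
    using assms(2) by (auto simp: coprime_dvd_mult_right_iff coprime_dvd_mult_left_iff)
qed

theorem theorem1:
  fixes f :: "int poly" and a :: "nat \<Rightarrow> int" and m :: nat
    and \<alpha> :: real and n d :: nat
  assumes f_eq: "f = (\<Sum>i\<le>m. monom (a i) i)"
    and primitive: "content f = 1"
    and alpha_pos: "\<alpha> > 0"
    and dominant: "real_of_int \<bar>a m\<bar> * \<alpha> ^ m > (\<Sum>i<m. real_of_int \<bar>a i\<bar> * \<alpha> ^ i)"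
    and n_pos: "n > 0" and d_pos: "d > 0"
    and n_ge: "real n \<ge> \<alpha> + real d"
    and value_at_n:
      "(\<exists>q::int. real_of_int \<bar>poly f (int n)\<bar> / real d = real_of_int q \<and> prime q) \<or>
       (\<exists>q::int. real_of_int \<bar>poly f (int n)\<bar> / real d = real_of_int q \<and> primepow q \<and>
                 coprime q \<bar>poly (pderiv f) (int n)\<bar>)"
  shows "irreducible f"
proof -
  have root_bound: "norm z < \<alpha>" if "poly (map_poly of_int f) z = 0" for z :: complex
  proof (rule dominant_leading_coeff_imp_root_bound[OF alpha_pos])
    show "(\<Sum>i<m. norm (of_int (a i) :: complex) * \<alpha> ^ i) < norm (of_int (a m) :: complex) * \<alpha> ^ m"
      using dominant by simp
    have "map_poly of_int f = (\<Sum>i\<le>m. monom (of_int (a i) :: complex) i)"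
      by (rule poly_eqI) (simp add: f_eq coeff_map_poly coeff_sum coeff_monom of_int_sum if_distrib)
    thus "(\<Sum>i\<le>m. of_int (a i) * z ^ i) = 0"
      using that by (simp add: poly_sum poly_monom)
  qed

  have value_gt: "\<bar>poly g (int n)\<bar> > int d" if "g dvd f" and deg: "degree g > 0" for g
  proof -
    let ?G = "map_poly of_int g :: complex poly"
    have "norm (poly ?G (of_nat n)) > real d"
    proof (rule norm_poly_gt_if_far_from_roots)
      show "degree ?G > 0" using deg by (simp add: degree_map_poly)
      have "lead_coeff g \<noteq> 0" using deg by auto
      hence "1 \<le> \<bar>lead_coeff g\<bar>" by linarith
      hence "1 \<le> real_of_int \<bar>lead_coeff g\<bar>" by linarith
      thus "norm (lead_coeff ?G) \<ge> 1" by (simp add: coeff_map_poly degree_map_poly)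
      show "real d \<ge> 1" using d_pos by simp
      fix z assume z: "poly ?G z = 0"
      obtain h where "f = g * h" using \<open>g dvd f\<close> unfolding dvd_def by blast
      hence "map_poly of_int f = ?G * map_poly of_int h"
        by (simp add: poly_eqI coeff_map_poly coeff_mult)
      hence "norm z < \<alpha>" using z by (intro root_bound) simp
      moreover have "real n \<le> norm (of_nat n - z) + norm z"
        by (metis norm_of_nat norm_triangle_sub add.commute)
      ultimately show "norm (of_nat n - z) > real d" using n_ge by linarith
    qed
    moreover have "poly ?G (of_nat n) = of_int (poly g (int n))"
      by (induction g) (simp_all add: map_poly_pCons)
    ultimately show ?thesis by simp
  qed

  obtain q :: int where fn: "\<bar>poly f (int n)\<bar> = int d * q" and "q > 1"
    and q_cases: "prime q \<or> primepow q \<and> coprime q (poly (pderiv f) (int n))"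
  proof -
    obtain q :: int where q: "real_of_int \<bar>poly f (int n)\<bar> / real d = real_of_int q"
      and "prime q \<or> primepow q \<and> coprime q (poly (pderiv f) (int n))"
      using value_at_n by auto
    moreover have "q > 1"
      using calculation(2) prime_gt_1_int
      by (auto simp: primepow_def intro: one_less_power prime_gt_1_int)
    moreover have "real_of_int \<bar>poly f (int n)\<bar> = real_of_int (int d * q)"
      using q d_pos by (simp add: field_simps)
    hence "\<bar>poly f (int n)\<bar> = int d * q" by linarith
    ultimately show ?thesis using that by blast
  qed
  have value_factor: "q dvd poly g (int n) \<or> q dvd poly h (int n)" if "f = g * h" for g h
  proof -
    have "q dvd poly (g * h) (int n)" using fn that by (metis dvd_abs_iff dvd_triv_right)
    show ?thesis using q_cases
    proof
      assume "prime q"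
      thus ?thesis using \<open>q dvd poly (g * h) (int n)\<close> by (simp add: prime_dvd_mult_iff)
    next
      assume *: "primepow q \<and> coprime q (poly (pderiv f) (int n))"
      then obtain p k where pk: "prime p" "k > 0" "q = p ^ k"
        by (auto simp: primepow_def)
      have "p dvd q" using pk by simp
      hence "\<not> p dvd poly (pderiv f) (int n)"
        using * \<open>prime p\<close> by (meson coprime_common_divisor not_prime_unit)
      thus ?thesis
        using prime_power_dvd_poly_factor pk \<open>q dvd poly (g * h) (int n)\<close> that by blast
    qed
  qed

  show ?thesis
  proof (rule irreducibleI)
    show "f \<noteq> 0" using primitive by auto
    show "\<not> is_unit f"
    proof
      assume "is_unit f"
      hence "is_unit (poly f (int n))" by (auto simp: is_unit_poly_iff)
      hence "int d * q = 1" using fn by simp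
      thus False using d_pos \<open>q > 1\<close> by (simp add: zmult_eq_1_iff)
    qed
    fix g h assume gh: "f = g * h"
    show "is_unit g \<or> is_unit h"
    proof (rule ccontr)
      assume "\<not> (is_unit g \<or> is_unit h)"
      hence "degree g > 0" "degree h > 0"
        using degree_pos_if_dvd_primitive[OF _ primitive] gh by auto
      hence gt: "\<bar>poly g (int n)\<bar> > int d" "\<bar>poly h (int n)\<bar> > int d"
        using value_gt gh by auto
      have "\<not> q dvd poly g (int n)" "\<not> q dvd poly h (int n)"
        using not_dvd_if_cofactor_gt[of "poly g (int n)" "poly h (int n)" "int d" q]
          not_dvd_if_cofactor_gt[of "poly h (int n)" "poly g (int n)" "int d" q]
          gt fn gh d_pos \<open>q > 1\<close> by (auto simp: mult.commute)
      thus False using value_factor[OF gh] by blast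
    qed
  qed
qed

end
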